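(* Let $k\ge 1$, $0\le \ell\le k-1$ and $r\ge 0$ be integers. The number $\bar{\mathcal P}_{r,k,\ell}$ of $k$-paths of length $n=kr+2\ell$ such that (iii) each internal $u$-segment has length equal to a multiple of $k$, and (iv) the first $u$-segment has length $\equiv \ell \pmod k$, is $$\bar{\mathcal P}_{r,k,\ell}=\sum_{p=0}^{\lfloor r/2\rfloor}\frac{\ell+1}{kp+\ell+1}\binom{(k+1)p+\ell}{p}\binom{r+(k-1)p+\ell}{r-2p}.$$
   Context: For $k\ge1$, a $k$-path of length $n$ is a lattice path from $(0,0)$ to $(n,0)$ with steps $u=(1,1)$, $d=(1,-1)$, $h=(k,0)$ that never goes below the $x$-axis. A $u$-segment of a $k$-path is a maximal sequence of consecutive up-steps; its length is its number of up-steps. An internal $u$-segment is a $u$-segment lying between two steps each of which is $d$ or $h$ (so any $u$-segment preceded by some step is internal). The first $u$-segment is the (possibly empty) run of up-steps with which the path begins; it has length $0$ if the path is empty or begins with $h$. *)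

theory Defs
  imports Complex_Main "HOL-Library.Product_Plus" "HOL-Number_Theory.Cong"
begin

datatype step = U | D | H

text \<open>
  A path starting at the origin is encoded by its list of steps. Since steps are letters and not
  vectors, \<open>H\<close> is distinct from \<open>U\<close> and \<open>D\<close> for every \<open>k\<close>.
\<close>

fun step_vec :: "nat \<Rightarrow> step \<Rightarrow> int \<times> int" where
  "step_vec k U = (1, 1)"
| "step_vec k D = (1, -1)"
| "step_vec k H = (int k, 0)"

definition endpoint :: "nat \<Rightarrow> step list \<Rightarrow> int \<times> int" where
  "endpoint k w = (\<Sum>s\<leftarrow>w. step_vec k s)"

definition k_path :: "nat \<Rightarrow> nat \<Rightarrow> step list \<Rightarrow> bool" where
  "k_path k n w \<longleftrightarrow>
     endpoint k w = (int n, 0) \<and> (\<forall>i\<le>length w. 0 \<le> snd (endpoint k (take i w)))"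

text \<open>
  \<open>u_segment w xs m ys\<close>: the nonempty block of \<open>m\<close> up-steps that lies between the prefix \<open>xs\<close> and
  the suffix \<open>ys\<close> of \<open>w\<close> is a maximal run of up-steps.
\<close>

definition u_segment :: "step list \<Rightarrow> step list \<Rightarrow> nat \<Rightarrow> step list \<Rightarrow> bool" where
  "u_segment w xs m ys \<longleftrightarrow>
     w = xs @ replicate m U @ ys \<and> 0 < m \<and>
     (xs = [] \<or> last xs \<noteq> U) \<and> (ys = [] \<or> hd ys \<noteq> U)"

definition internal_u_segment :: "step list \<Rightarrow> step list \<Rightarrow> nat \<Rightarrow> step list \<Rightarrow> bool" where
  "internal_u_segment w xs m ys \<longleftrightarrow>
     u_segment w xs m ys \<and>
     xs \<noteq> [] \<and> last xs \<in> {D, H} \<and> ys \<noteq> [] \<and> hd ys \<in> {D, H}"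

definition first_u_segment_length :: "step list \<Rightarrow> nat" where
  "first_u_segment_length w = length (takeWhile (\<lambda>s. s = U) w)"

definition P_bar_paths :: "nat \<Rightarrow> nat \<Rightarrow> nat \<Rightarrow> step list set" where
  "P_bar_paths r k l =
     {w. k_path k (k * r + 2 * l) w \<and>
         (\<forall>xs m ys. internal_u_segment w xs m ys \<longrightarrow> k dvd m) \<and>
         [first_u_segment_length w = l] (mod k)}"

end

theory Submission
  imports Defs
begin

text \<open>
  Conditions (iii) and (iv) say exactly that the path is \<open>u\<^sup>\<ell>\<close> followed by a word in the letters
  \<open>u\<^sup>k\<close>, \<open>d\<close>, \<open>h\<close>. Such words, started at height \<open>a\<close> and with prescribed numbers \<open>q\<close> of
  blocks \<open>u\<^sup>k\<close> and \<open>m\<close> of letters \<open>h\<close>, are counted by removing the first letter: the resulting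
  recursion is solved by the ballot number for the \<open>u\<^sup>k\<close>-\<open>d\<close>-word times the number of ways of
  inserting the letters \<open>h\<close>. Comparing lengths, a path with \<open>p\<close> blocks has \<open>r - 2p\<close> letters \<open>h\<close>.
\<close>

section \<open>Paths and run lengths as recursions over words\<close>

text \<open>The height is the only state, and as a natural number it cannot become negative.
  \<open>k\<close> is absent because the horizontal extent is recovered later from letter
  counts.\<close>

fun descends :: "nat \<Rightarrow> step list \<Rightarrow> bool" where
  "descends a [] \<longleftrightarrow> a = 0"
| "descends a (U # w) \<longleftrightarrow> descends (Suc a) w"
| "descends a (D # w) \<longleftrightarrow> 0 < a \<and> descends (a - 1) w"
| "descends a (H # w) \<longleftrightarrow> descends a w"

text \<open>The argument \<open>c\<close> is the number of up-steps already read in the current run.\<close>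

fun runs_dvd :: "nat \<Rightarrow> nat \<Rightarrow> step list \<Rightarrow> bool" where
  "runs_dvd k c [] \<longleftrightarrow> k dvd c"
| "runs_dvd k c (U # w) \<longleftrightarrow> runs_dvd k (Suc c) w"
| "runs_dvd k c (D # w) \<longleftrightarrow> k dvd c \<and> runs_dvd k 0 w"
| "runs_dvd k c (H # w) \<longleftrightarrow> k dvd c \<and> runs_dvd k 0 w"

lemma descends_replicate_U [simp]: "descends a (replicate n U @ w) \<longleftrightarrow> descends (a + n) w"
  by (induction n arbitrary: a) auto

text \<open>A final up-step would have to start at height -1. Hence no u-segment ends a path, and
  being internal reduces to having a nonempty prefix.\<close>

lemma descends_last_neq_U: "descends a w \<Longrightarrow> w \<noteq> [] \<Longrightarrow> last w \<noteq> U"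
  by (induction a w rule: descends.induct) (auto split: if_splits)

lemma endpoint_Nil [simp]: "endpoint k [] = 0"
  by (simp add: endpoint_def)

lemma endpoint_Cons [simp]: "endpoint k (s # w) = step_vec k s + endpoint k w"
  by (simp add: endpoint_def)

lemma all_le_Suc_iff: "(\<forall>i\<le>Suc n. P i) \<longleftrightarrow> P 0 \<and> (\<forall>i\<le>n. P (Suc i))"
  using All_less_Suc2[of "Suc n" P] by (simp add: less_Suc_eq_le)

lemma descends_iff:
  "descends a w \<longleftrightarrow>
     int a + snd (endpoint k w) = 0 \<and> (\<forall>i\<le>length w. 0 \<le> int a + snd (endpoint k (take i w)))"
proof (induction a w rule: descends.induct)
  case (3 a w)
  show ?case
  proof (cases a)
    case 0
    then have "\<not> (\<forall>i\<le>length (D # w). 0 \<le> int a + snd (endpoint k (take i (D # w))))"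
      \<comment> \<open>The prefix of length 1 already reaches height -1.\<close>
      by (auto intro!: exI[of _ 1])
    with 0 show ?thesis by auto
  next
    case (Suc b)
    with 3 show ?thesis by (simp add: all_le_Suc_iff)
  qed
next
  case (2 a w)
  have "int (Suc a) + x = int a + (1 + x)" for x by simp
  with 2 show ?case by (simp only: descends.simps) (simp add: all_le_Suc_iff)
qed (simp_all add: all_le_Suc_iff)

text \<open>Getting from height \<open>a\<close> to 0 takes \<open>a\<close> more down-steps than
  up-steps, which eliminates the letters \<open>D\<close> from the length.\<close>

lemma fst_endpoint_descends:
  "descends a w \<Longrightarrow>
     fst (endpoint k w) = int (2 * count_list w U + a + k * count_list w H)"
  by (induction a w rule: descends.induct) (auto simp: algebra_simps)

lemma k_path_iff:
  "k_path k n w \<longleftrightarrow> descends 0 w \<and> n = 2 * count_list w U + k * count_list w H"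
proof -
  have "fst (endpoint k w) = int n \<longleftrightarrow> n = 2 * count_list w U + k * count_list w H"
    if "descends 0 w"
    unfolding fst_endpoint_descends[OF that] of_nat_eq_iff by auto
  then show ?thesis
    using descends_iff[of 0 w k] by (auto simp: k_path_def prod_eq_iff)
qed

text \<open>The counter is only ever tested for divisibility by \<open>k\<close>.\<close>

lemma runs_dvd_add_self: "runs_dvd k (c + k) w \<longleftrightarrow> runs_dvd k c w"
  by (induction k c w rule: runs_dvd.induct) auto

lemma runs_dvd_replicate_U: "runs_dvd k c (replicate n U @ w) \<longleftrightarrow> runs_dvd k (c + n) w"
  by (induction n arbitrary: c) auto

lemma runs_dvd_block [simp]: "runs_dvd k 0 (replicate k U @ w) \<longleftrightarrow> runs_dvd k 0 w"
  using runs_dvd_add_self[of k 0 w] by (simp add: runs_dvd_replicate_U)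

text \<open>While \<open>d\<close> is positive, \<open>k - d\<close> is not a multiple of
  \<open>k\<close>, so the run cannot stop and the next letter must be \<open>U\<close>. Used with
  \<open>d = l\<close> for the initial up-steps and with \<open>d = k - 1\<close> to complete a
  block.\<close>

lemma runs_dvd_diff_iff:
  assumes "d < k"
  shows "runs_dvd k (k - d) w \<longleftrightarrow> (\<exists>v. w = replicate d U @ v \<and> runs_dvd k 0 v)"
  using assms
proof (induction d arbitrary: w)
  case 0
  then show ?case using runs_dvd_add_self[of k 0 w] by simp
next
  case (Suc d)
  have ndvd: "\<not> k dvd k - Suc d"
    using Suc.prems by (auto dest: dvd_imp_le)
  have Suc_diff: "Suc (k - Suc d) = k - d"
    using Suc.prems by simp
  show ?case
  proof (cases w)
    case (Cons s w')
    with Suc ndvd show ?thesis by (cases s) (auto simp: Suc_diff)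
  qed (use ndvd in auto)
qed

lemma runs_dvd_count: "runs_dvd k c w \<Longrightarrow> k dvd c + count_list w U"
  by (induction k c w rule: runs_dvd.induct) auto

lemma takeWhile_dropWhile_replicate:
  "takeWhile (\<lambda>s. s = x) (replicate n x @ ys) = replicate n x @ takeWhile (\<lambda>s. s = x) ys"
  "dropWhile (\<lambda>s. s = x) (replicate n x @ ys) = dropWhile (\<lambda>s. s = x) ys"
  by (induction n) auto

section \<open>Divisibility of u-segments\<close>

lemma u_segment_Nil_iff:
  "u_segment w [] m ys \<longleftrightarrow>
     0 < m \<and> m = first_u_segment_length w \<and> ys = dropWhile (\<lambda>s. s = U) w"
proof
  assume *: "u_segment w [] m ys"
  then have "takeWhile (\<lambda>s. s = U) ys = []" "dropWhile (\<lambda>s. s = U) ys = ys"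
    by (cases ys; auto simp: u_segment_def)+
  with * show "0 < m \<and> m = first_u_segment_length w \<and> ys = dropWhile (\<lambda>s. s = U) w"
    by (auto simp: u_segment_def first_u_segment_length_def takeWhile_dropWhile_replicate)
next
  assume *: "0 < m \<and> m = first_u_segment_length w \<and> ys = dropWhile (\<lambda>s. s = U) w"
  have "takeWhile (\<lambda>s. s = U) w = replicate (first_u_segment_length w) U"
    by (auto simp: first_u_segment_length_def dest: set_takeWhileD intro!: replicate_eqI)
  then have "w = replicate (first_u_segment_length w) U @ dropWhile (\<lambda>s. s = U) w"
    by (metis takeWhile_dropWhile_id)
  with * hd_dropWhile[of "\<lambda>s. s = U" w] show "u_segment w [] m ys"
    by (auto simp: u_segment_def)
qed

lemma u_segment_Cons_iff:
  "u_segment (s # w) (x # xs) m ys \<longleftrightarrow> x = s \<and> (xs = [] \<longrightarrow> s \<noteq> U) \<and> u_segment w xs m ys"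
  by (auto simp: u_segment_def)

text \<open>The initial run continues the \<open>c\<close> up-steps already read; every later run
  follows a letter that resets the counter to 0.\<close>

lemma runs_dvd_iff:
  "runs_dvd k c w \<longleftrightarrow>
     k dvd c + first_u_segment_length w \<and>
     (\<forall>xs m ys. xs \<noteq> [] \<longrightarrow> u_segment w xs m ys \<longrightarrow> k dvd m)"
proof -
  define I where
    "I w \<longleftrightarrow> (\<forall>xs m ys. xs \<noteq> [] \<longrightarrow> u_segment w xs m ys \<longrightarrow> k dvd m)" for w
  have I_Nil: "I []"
    by (simp add: I_def u_segment_def)
  \<comment> \<open>A new first letter other than \<open>U\<close> gives the initial run of
    \<open>w\<close> a nonempty prefix, so it joins the tested segments; a new \<open>U\<close>
    merges with that run instead.\<close>
  have I_Cons: "I (s # w) \<longleftrightarrow> (s \<noteq> U \<longrightarrow> k dvd first_u_segment_length w) \<and> I w"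
    (is "?L \<longleftrightarrow> ?R") for s w
  proof
    assume L: ?L
    show ?R
      unfolding I_def
    proof (intro conjI impI allI)
      assume "s \<noteq> U"
      then show "k dvd first_u_segment_length w"
        using L[unfolded I_def, rule_format, of "[s]" "first_u_segment_length w"
            "dropWhile (\<lambda>s. s = U) w"]
        \<comment> \<open>An empty run is not a u-segment, but its length 0 is divisible by
          \<open>k\<close> anyway.\<close>
        by (cases "first_u_segment_length w = 0") (auto simp: u_segment_Cons_iff u_segment_Nil_iff)
    next
      fix xs m ys
      assume "xs \<noteq> []" "u_segment w xs m ys"
      then show "k dvd m"
        using L[unfolded I_def, rule_format, of "s # xs" m ys] by (auto simp: u_segment_Cons_iff)
    qed
  next
    assume R: ?R
    show ?L
      unfolding I_def
    proof (intro allI impI)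
      fix xs m ys
      assume "xs \<noteq> []" and seg: "u_segment (s # w) xs m ys"
      then obtain xs' where xs: "xs = s # xs'"
        by (cases xs) (auto simp: u_segment_Cons_iff)
      with seg R show "k dvd m"
        by (cases "xs' = []") (auto simp: I_def u_segment_Cons_iff u_segment_Nil_iff)
    qed
  qed
  have "runs_dvd k c w \<longleftrightarrow> k dvd c + first_u_segment_length w \<and> I w"
  proof (induction w arbitrary: c)
    case (Cons s w)
    then show ?case
      by (cases s) (auto simp: I_Cons first_u_segment_length_def)
  qed (simp add: I_Nil first_u_segment_length_def)
  then show ?thesis
    by (simp add: I_def)
qed

text \<open>The initial counter \<open>k - l\<close> stands for -l modulo \<open>k\<close> within
  the naturals, turning the congruence on the first run into divisibility.\<close>

lemma P_bar_paths_iff: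
  assumes "l < k"
  shows "w \<in> P_bar_paths r k l \<longleftrightarrow> k_path k (k * r + 2 * l) w \<and> runs_dvd k (k - l) w"
proof -
  have first: "[f = l] (mod k) \<longleftrightarrow> k dvd k - l + f" for f
  proof -
    have "[f = l] (mod k) \<longleftrightarrow> [k - l + f = k - l + l] (mod k)"
      by (rule cong_add_lcancel_nat[symmetric])
    also have "\<dots> \<longleftrightarrow> k dvd k - l + f"
      using assms by (simp add: cong_def dvd_eq_mod_eq_0)
    finally show ?thesis .
  qed
  have "internal_u_segment w xs m ys \<longleftrightarrow> xs \<noteq> [] \<and> u_segment w xs m ys"
    if "descends 0 w" for xs m ys
  proof -
    have *: "s \<in> {D, H} \<longleftrightarrow> s \<noteq> U" for s by (cases s) auto
    have "ys \<noteq> []" if "u_segment w xs m ys"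
      using descends_last_neq_U[OF \<open>descends 0 w\<close>] that by (auto simp: u_segment_def)
    then show ?thesis
      unfolding internal_u_segment_def * by (auto simp: u_segment_def)
  qed
  then show ?thesis
    unfolding P_bar_paths_def mem_Collect_eq runs_dvd_iff first k_path_iff by blast
qed

section \<open>Block words and their first letter\<close>

definition block_words :: "nat \<Rightarrow> nat \<Rightarrow> nat \<Rightarrow> nat \<Rightarrow> step list set" where
  "block_words k a q m =
     {w. runs_dvd k 0 w \<and> descends a w \<and> count_list w U = k * q \<and> count_list w H = m}"

lemma count_list_replicate [simp]: "count_list (replicate n x) y = (if x = y then n else 0)"
  by (induction n) auto

lemma block_words_rec:
  assumes "0 < k"
  shows "block_words k a q m =
    (if a = 0 \<and> q = 0 \<and> m = 0 then {[]} else {}) \<union>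
    (if q = 0 then {} else (@) (replicate k U) ` block_words k (a + k) (q - 1) m) \<union>
    (if a = 0 then {} else (#) D ` block_words k (a - 1) q m) \<union>
    (if m = 0 then {} else (#) H ` block_words k a q (m - 1))"
    (is "_ = ?N \<union> ?U \<union> ?D \<union> ?H")
proof (intro equalityI subsetI)
  fix w assume w: "w \<in> block_words k a q m"
  consider "w = []" | w' where "w = U # w'" | w' where "w = D # w'" | w' where "w = H # w'"
    by (metis neq_Nil_conv step.exhaust)
  then show "w \<in> ?N \<union> ?U \<union> ?D \<union> ?H"
  proof cases
    case 1
    with w assms show ?thesis by (auto simp: block_words_def)
  next
    case (2 w')
    \<comment> \<open>One up-step has been read and \<open>1 = k - (k - 1)\<close>, so the other
      \<open>k - 1\<close> up-steps of the block are forced.\<close>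
    with w have "runs_dvd k (k - (k - 1)) w'"
      using assms by (simp add: block_words_def)
    with assms obtain v where "w' = replicate (k - 1) U @ v" "runs_dvd k 0 v"
      by (subst (asm) runs_dvd_diff_iff) auto
    with assms 2 have v: "w = replicate k U @ v" "runs_dvd k 0 v"
      by (cases k; simp)+
    with w have "k + count_list v U = k * q" by (simp add: block_words_def)
    with assms have "q \<noteq> 0" "count_list v U = k * (q - 1)"
      by (auto simp: diff_mult_distrib2 intro: gr0I)
    with v w show ?thesis by (auto simp: block_words_def)
  next
    case 3
    with w show ?thesis by (auto simp: block_words_def)
  next
    case 4
    with w show ?thesis by (auto simp: block_words_def)
  qed
next
  fix w assume "w \<in> ?N \<union> ?U \<union> ?D \<union> ?H"
  then show "w \<in> block_words k a q m"
    by (cases q) (auto simp: block_words_def split: if_splits)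
qed

section \<open>Raney numbers\<close>

text \<open>The Raney number with parameters \<open>k + 1\<close> and \<open>a + 1\<close>; for
  \<open>a = 0\<close> it is a Fuss-Catalan number.\<close>

definition raney :: "nat \<Rightarrow> nat \<Rightarrow> nat \<Rightarrow> real" where
  "raney k a q = real (a + 1) / real (k * q + a + 1) * real (((k + 1) * q + a) choose q)"

lemma raney_fact:
  "raney k a q = real (a + 1) * fact ((k + 1) * q + a) / (fact q * fact (k * q + a + 1))"
proof -
  have "real (((k + 1) * q + a) choose q) = fact ((k + 1) * q + a) / (fact q * fact (k * q + a))"
    by (subst binomial_fact) (simp_all add: algebra_simps)
  moreover have "fact (k * q + a + 1) = real (k * q + a + 1) * fact (k * q + a)"
    by simp
  ultimately show ?thesis
    unfolding raney_def by (simp only: times_divide_times_eq ac_simps)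
qed

lemma raney_0 [simp]: "raney k a 0 = 1"
  by (simp add: raney_def)

text \<open>This mirrors the two possible first letters of a word without \<open>H\<close>: a block,
  leading to height \<open>a + k\<close>, or a down-step.\<close>

lemma raney_Suc:
  "raney k a (Suc q) = raney k (a + k) q + (if a = 0 then 0 else raney k (a - 1) (Suc q))"
proof -
  \<comment> \<open>\<open>F\<close> and \<open>G\<close> are the factorials common to all three
    terms; cancelling them leaves a polynomial identity.\<close>
  define F :: real where "F = fact (k * Suc q + q + a)"
  define G :: real where "G = fact (k * Suc q + a)"
  define Q where "Q = real (Suc q)"
  define K where "K = real k * Q + real a + 1"
  have pos: "G > 0" "K > 0" "Q > 0" by (simp_all add: G_def K_def Q_def add_nonneg_pos)
  have lhs: "raney k a (Suc q) = (real a + 1) * ((K + real q) * F) / (Q * fact q * (K * G))"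
    by (simp add: raney_fact F_def G_def K_def Q_def algebra_simps)
  have up: "raney k (a + k) q = (real a + real k + 1) * F / (fact q * (K * G))"
    by (simp add: raney_fact F_def G_def K_def Q_def algebra_simps)
  \<comment> \<open>The factor \<open>real a\<close> vanishes exactly when the \<open>if\<close>
    yields 0.\<close>
  have down: "(if a = 0 then 0 else raney k (a - 1) (Suc q)) = real a * F / (Q * fact q * G)"
    by (cases a) (simp_all add: raney_fact F_def G_def Q_def algebra_simps)
  have "(real a + 1) * (K + real q) = (real a + real k + 1) * Q + real a * K"
    by (simp add: K_def Q_def algebra_simps)
  then have "raney k a (Suc q) =
      ((real a + real k + 1) * Q + real a * K) * F / (Q * fact q * (K * G))"
    unfolding lhs by (metis mult.assoc)
  also have "\<dots> = (real a + real k + 1) * F / (fact q * (K * G)) + real a * F / (Q * fact q * G)"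
    using pos by (simp add: add_divide_distrib distrib_right)
  finally show ?thesis
    unfolding up down .
qed

section \<open>Counting block words\<close>

text \<open>The induction measure is the number of letters when a block counts as one:
  \<open>q\<close> blocks, \<open>k * q + a\<close> down-steps and \<open>m\<close> letters
  \<open>H\<close>. The binomial chooses the positions of the \<open>H\<close>.\<close>

lemma card_block_words:
  assumes "0 < k"
  shows "finite (block_words k a q m) \<and>
    real (card (block_words k a q m)) = raney k a q * real (((k + 1) * q + a + m) choose m)"
proof (induction "(k + 1) * q + a + m" arbitrary: a q m rule: less_induct)
  case less
  define n where "n = (k + 1) * q + a"
  define N where "N = (if a = 0 \<and> q = 0 \<and> m = 0 then {[] :: step list} else {})"
  define U' where "U' = (if q = 0 then {} else (@) (replicate k U) ` block_words k (a + k) (q - 1) m)"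
  define D' where "D' = (if a = 0 then {} else (#) D ` block_words k (a - 1) q m)"
  define H' where "H' = (if m = 0 then {} else (#) H ` block_words k a q (m - 1))"
  have eq: "block_words k a q m = N \<union> U' \<union> D' \<union> H'"
    unfolding N_def U'_def D'_def H'_def by (rule block_words_rec[OF assms])
  \<comment> \<open>Since \<open>k\<close> is positive, a block starts with \<open>U\<close>, so the
    first letter separates the four sets.\<close>
  have hd_U: "replicate k U = U # replicate (k - 1) U"
    using assms by (cases k) auto
  have disj: "N \<inter> U' = {}" "(N \<union> U') \<inter> D' = {}" "(N \<union> U' \<union> D') \<inter> H' = {}"
    unfolding N_def U'_def D'_def H'_def hd_U by auto
  have finN: "finite N" and cardN: "card N = (if n + m = 0 then 1 else 0)"
    by (auto simp: N_def n_def)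
  have U: "finite U' \<and> real (card U') =
      (if q = 0 then 0 else raney k (a + k) (q - 1) * real ((n - 1 + m) choose m))"
  proof (cases q)
    case (Suc q')
    have "n - 1 = (k + 1) * q' + (a + k)" by (simp add: n_def Suc)
    with less[of q' "a + k" m] Suc show ?thesis
      by (simp add: U'_def card_image inj_on_def)
  qed (simp add: U'_def)
  have D: "finite D' \<and> real (card D') =
      (if a = 0 then 0 else raney k (a - 1) q * real ((n - 1 + m) choose m))"
  proof (cases a)
    case (Suc a')
    have "n - 1 = (k + 1) * q + a'" by (simp add: n_def Suc)
    with less[of q a' m] Suc show ?thesis
      by (simp add: D'_def card_image inj_on_def)
  qed (simp add: D'_def)
  have H: "finite H' \<and> real (card H') =
      (if m = 0 then 0 else raney k a q * real ((n + m - 1) choose (m - 1)))"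
  proof (cases m)
    case (Suc m')
    with less[of q a m'] show ?thesis
      by (simp add: H'_def card_image inj_on_def n_def)
  qed (simp add: H'_def)
  have card: "real (card (block_words k a q m)) =
      real (card N) + real (card U') + real (card D') + real (card H')"
    unfolding eq using finN U D H disj by (simp add: card_Un_disjoint)
  have "\<dots> = raney k a q * real ((n + m) choose m)"
  \<comment> \<open>For \<open>n = 0\<close> the only word is \<open>replicate m H\<close>; it is
    treated apart because \<open>n - 1\<close> truncates.\<close>
  proof (cases "n = 0")
    case True
    then have "a = 0" "q = 0" by (simp_all add: n_def)
    with True U D H cardN show ?thesis by (cases m) simp_all
  next
    case False
    \<comment> \<open>For \<open>q = 0\<close>, \<open>n\<close> being nonzero forces
      \<open>a > 0\<close>, and both sides are 1.\<close>
    have "raney k a q = (if q = 0 then 0 else raney k (a + k) (q - 1)) +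
        (if a = 0 then 0 else raney k (a - 1) q)"
      using False by (cases q) (auto simp: n_def raney_Suc)
    then have UD: "real (card U') + real (card D') = raney k a q * real ((n - 1 + m) choose m)"
      using U D by (auto simp: distrib_right)
    \<comment> \<open>Pascal's rule, according to whether the first letter is
      \<open>H\<close>.\<close>
    have "real ((n + m) choose m) =
        real ((n - 1 + m) choose m) + (if m = 0 then 0 else real ((n + m - 1) choose (m - 1)))"
      using False by (cases n; cases m) simp_all
    with UD cardN False H show ?thesis by (auto simp: distrib_left)
  qed
  with card finN U D H show ?case by (simp add: eq n_def)
qed

section \<open>Decomposition of the paths and summation\<close>

text \<open>With \<open>p\<close> blocks and \<open>m\<close> letters \<open>H\<close>, the length
  is \<open>2 * (l + k * p) + k * m\<close>; equating it to \<open>k * r + 2 * l\<close> and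
  cancelling \<open>k\<close> gives \<open>m = r - 2 * p\<close>.\<close>

lemma P_bar_paths_eq:
  assumes "l < k"
  shows "P_bar_paths r k l =
    (\<Union>p\<in>{0..r div 2}. (@) (replicate l U) ` block_words k l p (r - 2 * p))"
proof (intro equalityI subsetI)
  fix w assume w: "w \<in> P_bar_paths r k l"
  then obtain v where v: "w = replicate l U @ v" "runs_dvd k 0 v"
    using assms by (auto simp: P_bar_paths_iff runs_dvd_diff_iff)
  from runs_dvd_count[OF v(2)] obtain p where p: "count_list v U = k * p"
    by auto
  from w v p assms have "descends l v" "k * r = k * (2 * p + count_list v H)"
    by (auto simp: P_bar_paths_iff k_path_iff algebra_simps)
  moreover from this(2) assms have "r = 2 * p + count_list v H"
    by (metis mult_cancel1 not_less_zero)
  ultimately show "w \<in> (\<Union>p\<in>{0..r div 2}. (@) (replicate l U) ` block_words k l p (r - 2 * p))"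
    using v p by (auto simp: block_words_def intro!: bexI[of _ p])
next
  fix w assume "w \<in> (\<Union>p\<in>{0..r div 2}. (@) (replicate l U) ` block_words k l p (r - 2 * p))"
  then obtain p where "p \<le> r div 2" and "w \<in> (@) (replicate l U) ` block_words k l p (r - 2 * p)"
    by auto
  then obtain v where w: "w = replicate l U @ v" and v: "v \<in> block_words k l p (r - 2 * p)"
    by auto
  \<comment> \<open>This bound keeps \<open>r - 2 * p\<close> from truncating.\<close>
  from \<open>p \<le> r div 2\<close> have "2 * p \<le> r" by auto
  then have "k * r = k * (2 * p + (r - 2 * p))"
    by simp
  then have "k * r = 2 * (k * p) + k * (r - 2 * p)"
    by (simp only: add_mult_distrib2 mult.left_commute)
  with v w assms show "w \<in> P_bar_paths r k l"
    by (auto simp: P_bar_paths_iff k_path_iff runs_dvd_diff_iff block_words_def)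
qed

theorem theorem5p2:
  fixes k l r :: nat
  assumes "1 \<le> k" and "l \<le> k - 1"
  shows "real (card (P_bar_paths r k l)) =
    (\<Sum>p = 0..r div 2.
       real (l + 1) / real (k * p + l + 1)
         * real (((k + 1) * p + l) choose p)
         * real ((r + (k - 1) * p + l) choose (r - 2 * p)))"
proof -
  have k: "0 < k" "l < k" using assms by auto
  define B where "B p = (@) (replicate l U) ` block_words k l p (r - 2 * p)" for p
  \<comment> \<open>The number of up-steps, \<open>l + k * p\<close>, determines
    \<open>p\<close>.\<close>
  have "B p \<inter> B p' = {}" if "p \<noteq> p'" for p p'
    using that k by (auto simp: B_def block_words_def)
  then have "card (P_bar_paths r k l) = (\<Sum>p = 0..r div 2. card (B p))"
    unfolding P_bar_paths_eq[OF k(2)] B_def[symmetric]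
    using card_block_words[OF k(1)] by (intro card_UN_disjoint) (auto simp: B_def)
  then have "real (card (P_bar_paths r k l)) = (\<Sum>p = 0..r div 2. real (card (B p)))"
    by simp
  also have "\<dots> = (\<Sum>p = 0..r div 2. raney k l p * real ((r + (k - 1) * p + l) choose (r - 2 * p)))"
  proof (rule sum.cong)
    fix p assume "p \<in> {0..r div 2}"
    then have "2 * p \<le> r" by auto
    \<comment> \<open>Rewrites the letter count \<open>(k + 1) * p + l + (r - 2 * p)\<close> into
      the upper index of the stated binomial.\<close>
    moreover have "(k + 1) * p = (k - 1) * p + 2 * p"
      using k by (cases k) auto
    ultimately have "(k + 1) * p + l + (r - 2 * p) = r + (k - 1) * p + l"
      by simp
    then have "real (card (block_words k l p (r - 2 * p))) =
        raney k l p * real ((r + (k - 1) * p + l) choose (r - 2 * p))"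
      using card_block_words[OF k(1), of l p "r - 2 * p"] by (simp only:)
    then show "real (card (B p)) = raney k l p * real ((r + (k - 1) * p + l) choose (r - 2 * p))"
      by (simp add: B_def card_image inj_on_def)
  qed simp
  finally show ?thesis by (simp only: raney_def)
qed

end
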